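(* Let $\mathcal H,\mathcal F$ be real or complex Hilbert spaces, $A\in L(\mathcal H,\mathcal F)$, $b\in\mathcal F$, let $W\in L(\mathcal F)$ be positive semidefinite with $W^{1/2}\in S_2$, and let $\rho>0$. Let $$G(x)=\frac{\|Ax-b\|_W^2}{1+\|x\|^2}+\rho\|x\|^2,\quad x\in\mathcal H,\qquad t^*:=\inf_{x\in\mathcal H}G(x).$$ If $\rho\ge t^*$, then the problem $$\min_{X\in L(\mathcal H,\mathcal F),\ x\in\mathcal H}\ \big(\|Tx\|^2+\|A-X\|_{2,W}^2+\|Xx-b\|_W^2\big)$$ with $T=\rho^{1/2}I$ has a unique solution.
   Context: $L(\mathcal H,\mathcal F)$ denotes the bounded linear operators from $\mathcal H$ to $\mathcal F$, $L(\mathcal F)=L(\mathcal F,\mathcal F)$, and $I$ is the identity operator on $\mathcal H$. $S_2$ is the Hilbert–Schmidt class with norm $\|\cdot\|_2$. Seminorms: $\|X\|_{2,W}:=\|W^{1/2}X\|_2$ for $X\in L(\mathcal H,\mathcal F)$ and $\|z\|_W:=\|W^{1/2}z\|$ for $z\in\mathcal F$. A solution of the problem is a pair $(A_0,x_0)\in L(\mathcal H,\mathcal F)\times\mathcal H$ attaining the minimum.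
   Formalization: For singular W uniqueness of the pair fails (W=0: every (X,0) is a solution), so the result proved is: solutions exist, x_0 is unique and A_0 is unique up to the seminorm ||.||_{2,W}; the pair is literally unique when ||.||_W is a norm (W injective). *)

theory Defs
  imports "HOL-Analysis.Analysis"
begin

text \<open>
  Scalar fields. The axioms force every instance to be (isomorphic to) the field of real numbers
  with trivial conjugation or the field of complex numbers with the usual one, so that a variable
  of this class reads ``real or complex scalars''.
\<close>

class rc_field = real_normed_field +
  fixes conjg :: "'a \<Rightarrow> 'a"
  assumes conjg_add: "conjg (a + b) = conjg a + conjg b"
    and conjg_mult: "conjg (a * b) = conjg a * conjg b"
    and conjg_conjg: "conjg (conjg a) = a"
    and mult_conjg: "a * conjg a = (norm a)\<^sup>2 *\<^sub>R 1"

instantiation real :: rc_field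
begin

definition conjg_real :: "real \<Rightarrow> real"
  where "conjg_real a = a"

instance
  by standard (simp_all add: conjg_real_def power2_eq_square)

end

instantiation complex :: rc_field
begin

definition conjg_complex :: "complex \<Rightarrow> complex"
  where "conjg_complex = cnj"

instance
proof
  show "a * conjg a = (norm a)\<^sup>2 *\<^sub>R 1" for a :: complex
    unfolding conjg_complex_def complex_norm_square[symmetric] scaleR_conv_of_real by simp
qed (simp_all add: conjg_complex_def)

end

text \<open>
  The additive, real-linear and metric structure of a Hilbert space lives on the type (completeness
  comes from \<^class>\<open>banach\<close>). The record adds the scalar multiplication and the inner product, which is
  linear in the first argument; the locale ties them to the structure of the type.
\<close>

record ('k, 'a) hilbert =
  smul :: "'k \<Rightarrow> 'a \<Rightarrow> 'a"
  ip :: "'a \<Rightarrow> 'a \<Rightarrow> 'k"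

locale hilbert_space =
  fixes H :: "('k::rc_field, 'a::banach) hilbert"
  assumes vector_space: "vector_space (smul H)"
    and smul_of_real: "smul H (of_real r) x = r *\<^sub>R x"
    and ip_add_left: "ip H (x + y) z = ip H x z + ip H y z"
    and ip_smul_left: "ip H (smul H c x) y = c * ip H x y"
    and ip_commute: "ip H y x = conjg (ip H x y)"
    and ip_self: "ip H x x = of_real ((norm x)\<^sup>2)"

lemma hilbert_space_real:
  "hilbert_space \<lparr>smul = scaleR, ip = (inner :: 'a::{real_inner, banach} \<Rightarrow> _)\<rparr>"
  by unfold_locales
    (simp_all add: conjg_real_def inner_add_left inner_add_right inner_commute scaleR_add_left
      scaleR_add_right
      dot_square_norm)

lemma hilbert_space_complex:
  "hilbert_space \<lparr>smul = (*), ip = (\<lambda>x y. x * cnj y)\<rparr>"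
proof unfold_locales
  show "ip \<lparr>smul = (*), ip = (\<lambda>x y. x * cnj y)\<rparr> x x = of_real ((norm x)\<^sup>2)" for x :: complex
    unfolding complex_norm_square by simp
qed (simp_all add: conjg_complex_def distrib_left distrib_right scaleR_conv_of_real)

text \<open>The space $L(H, F)$: library bounded (real-)linear operators that respect all scalars.\<close>

definition bops :: "('k::rc_field, 'h::banach) hilbert \<Rightarrow> ('k, 'f::banach) hilbert \<Rightarrow> ('h \<Rightarrow>\<^sub>L 'f) set"
  where "bops H F = {X. \<forall>c x. blinfun_apply X (smul H c x) = smul F c (blinfun_apply X x)}"

text \<open>Self-adjointness is automatic for complex scalars but not for real ones.\<close>

definition psd :: "('k::rc_field, 'f::banach) hilbert \<Rightarrow> ('f \<Rightarrow>\<^sub>L 'f) \<Rightarrow> bool"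
  where "psd F W \<longleftrightarrow> W \<in> bops F F \<and>
    (\<forall>x y. ip F (blinfun_apply W x) y = ip F x (blinfun_apply W y)) \<and>
    (\<forall>x. \<exists>r\<ge>0. ip F (blinfun_apply W x) x = of_real r)"

definition op_sqrt :: "('k::rc_field, 'f::banach) hilbert \<Rightarrow> ('f \<Rightarrow>\<^sub>L 'f) \<Rightarrow> ('f \<Rightarrow>\<^sub>L 'f)"
  where "op_sqrt F W = (THE R. psd F R \<and> R o\<^sub>L R = W)"

definition orthonormal_basis :: "('k::rc_field, 'h::banach) hilbert \<Rightarrow> 'h set \<Rightarrow> bool"
  where "orthonormal_basis H E \<longleftrightarrow>
    (\<forall>x\<in>E. \<forall>y\<in>E. ip H x y = (if x = y then 1 else 0)) \<and>
    closure (module.span (smul H) E) = UNIV"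

text \<open>
  Neither the Hilbert--Schmidt class nor the norm depends on the orthonormal basis. The value of
  \<open>hs_norm\<close> is meaningful only on that class: the infinite sum defaults to 0 if it diverges.
\<close>

definition hilbert_schmidt :: "('k::rc_field, 'h::banach) hilbert \<Rightarrow> ('k, 'f::banach) hilbert \<Rightarrow> ('h \<Rightarrow>\<^sub>L 'f) set"
  where "hilbert_schmidt H F = {X \<in> bops H F.
    \<exists>E. orthonormal_basis H E \<and> (\<lambda>e. (norm (blinfun_apply X e))\<^sup>2) summable_on E}"

definition hs_norm :: "('k::rc_field, 'h::banach) hilbert \<Rightarrow> ('h \<Rightarrow>\<^sub>L 'f::banach) \<Rightarrow> real"
  where "hs_norm H X =
    sqrt (\<Sum>\<^sub>\<infinity>e\<in>(SOME E. orthonormal_basis H E). (norm (blinfun_apply X e))\<^sup>2)"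

definition wnorm :: "('k::rc_field, 'f::banach) hilbert \<Rightarrow> ('f \<Rightarrow>\<^sub>L 'f) \<Rightarrow> 'f \<Rightarrow> real"
  where "wnorm F W z = norm (blinfun_apply (op_sqrt F W) z)"

definition hs_wnorm ::
  "('k::rc_field, 'h::banach) hilbert \<Rightarrow> ('k, 'f::banach) hilbert \<Rightarrow> ('f \<Rightarrow>\<^sub>L 'f) \<Rightarrow> ('h \<Rightarrow>\<^sub>L 'f) \<Rightarrow> real"
  where "hs_wnorm H F W X = hs_norm H (op_sqrt F W o\<^sub>L X)"

definition G_fun ::
  "('k::rc_field, 'f::banach) hilbert \<Rightarrow> ('h::banach \<Rightarrow>\<^sub>L 'f) \<Rightarrow> 'f \<Rightarrow> ('f \<Rightarrow>\<^sub>L 'f) \<Rightarrow> real \<Rightarrow> 'h \<Rightarrow> real"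
  where "G_fun F A b W \<rho> x =
    (wnorm F W (blinfun_apply A x - b))\<^sup>2 / (1 + (norm x)\<^sup>2) + \<rho> * (norm x)\<^sup>2"

definition rtls_objective ::
  "('k::rc_field, 'h::banach) hilbert \<Rightarrow> ('k, 'f::banach) hilbert \<Rightarrow> ('h \<Rightarrow>\<^sub>L 'f) \<Rightarrow> 'f \<Rightarrow>
   ('f \<Rightarrow>\<^sub>L 'f) \<Rightarrow> ('h \<Rightarrow>\<^sub>L 'h) \<Rightarrow> ('h \<Rightarrow>\<^sub>L 'f) \<times> 'h \<Rightarrow> real"
  where "rtls_objective H F A b W T = (\<lambda>(X, x).
    (norm (blinfun_apply T x))\<^sup>2 + (hs_wnorm H F W (A - X))\<^sup>2 + (wnorm F W (blinfun_apply X x - b))\<^sup>2)"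

definition rtls_solution ::
  "('k::rc_field, 'h::banach) hilbert \<Rightarrow> ('k, 'f::banach) hilbert \<Rightarrow> ('h \<Rightarrow>\<^sub>L 'f) \<Rightarrow> 'f \<Rightarrow>
   ('f \<Rightarrow>\<^sub>L 'f) \<Rightarrow> ('h \<Rightarrow>\<^sub>L 'h) \<Rightarrow> ('h \<Rightarrow>\<^sub>L 'f) \<times> 'h \<Rightarrow> bool"
  where "rtls_solution H F A b W T =
    is_arg_min (rtls_objective H F A b W T) (\<lambda>(X, x). X \<in> bops H F)"

end

theory Submission
  imports Defs
begin

text \<open>
  Write \<open>R\<close> for the square root of \<open>W\<close>. The proof minimises over the operator first, for fixed
  \<open>x\<close>, and then over \<open>x\<close>.

  Fix \<open>x\<close> and put \<open>q = (A x - b) / (1 + \<parallel>x\<parallel>\<^sup>2)\<close> and \<open>Z = A - \<langle>\<cdot>, x\<rangle> q\<close>. For any operator \<open>X\<close>, the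
  difference \<open>D = R (Z - X)\<close> enters the term \<open>\<parallel>R (A - X)\<parallel>\<^sub>2\<^sup>2\<close> through the cross term \<open>2 Re \<langle>R q, D x\<rangle>\<close>,
  because the Hilbert-Schmidt product of \<open>\<langle>\<cdot>, x\<rangle> R q\<close> and \<open>D\<close> is \<open>\<langle>R q, D x\<rangle>\<close>; it enters
  \<open>\<parallel>R (X x - b)\<parallel>\<^sup>2 = \<parallel>R q - D x\<parallel>\<^sup>2\<close> through the opposite cross term. So the objective at \<open>(X, x)\<close> equals
  \<open>G x + \<parallel>D\<parallel>\<^sub>2\<^sup>2 + \<parallel>D x\<parallel>\<^sup>2\<close> (\<open>rtls_objective_eq\<close>). Hence \<open>(X, x)\<close> is a solution iff \<open>x\<close> minimises \<open>G\<close> and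
  \<open>\<parallel>D\<parallel>\<^sub>2 = 0\<close>; when \<open>R\<close> is injective the latter says \<open>X = Z\<close>.

  It remains to see that \<open>G\<close> has exactly one minimiser (\<open>fractional_minimum_ex1\<close>). Let \<open>t\<close> be the
  infimum of \<open>G\<close>. Clearing the denominator, the minimisers of \<open>G\<close> are the zeros of the nonnegative
  function \<open>\<Phi> x = (1 + \<parallel>x\<parallel>\<^sup>2) (G x - t) = \<parallel>R A x - R b\<parallel>\<^sup>2 + (\<rho> - t) \<parallel>x\<parallel>\<^sup>2 + \<rho> \<parallel>x\<parallel>\<^sup>4 - t\<close>. Since \<open>\<rho> \<ge> t\<close>, all
  terms are convex, and the quartic one is uniformly convex: by the parallelogram law
  \<open>\<rho> \<parallel>x - y\<parallel>\<^sup>4 \<le> 8 (\<Phi> x + \<Phi> y)\<close>. This gives uniqueness, and it makes every minimising sequence of \<open>G\<close> a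
  Cauchy sequence, so that completeness gives existence.

  The sum that defines \<open>hs_norm\<close> must not diverge for any of the operators involved: this is the
  ideal property of the Hilbert-Schmidt class (\<open>hilbert_schmidt_comp_summable\<close>), which rests on
  Bessel's inequality and Parseval's identity. Orthonormal bases exist by Zorn's lemma.
\<close>

section \<open>Conjugation and the real part of the inner product\<close>

lemma conjg_of_real: "conjg (of_real r :: 'k::rc_field) = of_real r"
proof (cases "r = 0")
  case True
  have "conjg (0::'k) + conjg 0 = conjg 0"
    using conjg_add[of "0::'k" 0] by simp
  then show ?thesis
    using True by simp
next
  case False
  have "of_real r * conjg (of_real r :: 'k) = of_real r * of_real r"
    by (simp add: mult_conjg scaleR_conv_of_real power2_eq_square)
  then show ?thesis
    using False by simp
qed

lemma norm_conjg: "norm (conjg (a::'k::rc_field)) = norm a"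
proof -
  have "of_real ((norm (conjg a))\<^sup>2) = (of_real ((norm a)\<^sup>2) :: 'k)"
    using mult_conjg[of "conjg a"] mult_conjg[of a]
    by (simp add: conjg_conjg mult.commute scaleR_conv_of_real)
  then show ?thesis
    by (simp only: of_real_eq_iff power2_eq_iff_nonneg norm_ge_zero)
qed

text \<open>
  In a Hilbert space this is the real part of the inner product, by polarisation. Defined from the
  norm alone, it is a real number over either scalar field, and its Cauchy-Schwarz inequality is just
  the triangle inequality.
\<close>

definition re_ip :: "'a::real_normed_vector \<Rightarrow> 'a \<Rightarrow> real"
  where "re_ip x y = ((norm (x + y))\<^sup>2 - (norm x)\<^sup>2 - (norm y)\<^sup>2) / 2"

lemma norm_add_sq: "(norm (x + y))\<^sup>2 = (norm x)\<^sup>2 + (norm y)\<^sup>2 + 2 * re_ip x y"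
  by (simp add: re_ip_def field_simps)

lemma re_ip_self: "re_ip x x = (norm x)\<^sup>2"
proof -
  have "norm (x + x) = 2 * norm x"
    by (metis norm_scaleR abs_numeral scaleR_2)
  then show ?thesis
    by (simp add: re_ip_def power_mult_distrib)
qed

lemma abs_re_ip_le: "\<bar>re_ip x y\<bar> \<le> norm x * norm y"
proof -
  have "(norm (x + y))\<^sup>2 \<le> (norm x + norm y)\<^sup>2"
    by (intro power_mono norm_triangle_ineq) simp
  moreover have "\<bar>norm x - norm y\<bar> \<le> norm (x + y)"
    using norm_triangle_ineq3[of x "- y"] by simp
  then have "(norm x - norm y)\<^sup>2 \<le> (norm (x + y))\<^sup>2"
    by (metis abs_ge_zero power2_abs power_mono)
  ultimately show ?thesis
    by (simp add: re_ip_def abs_le_iff power2_sum power2_diff field_simps)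
qed

definition orthonormal :: "('k::rc_field, 'a) hilbert \<Rightarrow> 'a set \<Rightarrow> bool"
  where "orthonormal H E \<longleftrightarrow> (\<forall>x\<in>E. \<forall>y\<in>E. ip H x y = (if x = y then 1 else 0))"

lemma orthonormal_basisD: "orthonormal_basis H E \<Longrightarrow> orthonormal H E"
  unfolding orthonormal_basis_def orthonormal_def by blast

context hilbert_space
begin

sublocale vs: vector_space "smul H"
  by (rule vector_space)

lemma ip_add_right: "ip H x (y + z) = ip H x y + ip H x z"
  by (metis conjg_add ip_add_left ip_commute)

lemma ip_smul_right: "ip H x (smul H c y) = conjg c * ip H x y"
  by (metis conjg_mult ip_commute ip_smul_left)

lemma ip_scaleR_left: "ip H (r *\<^sub>R x) y = r *\<^sub>R ip H x y"
  by (metis ip_smul_left scaleR_conv_of_real smul_of_real)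

lemma ip_scaleR_right: "ip H x (r *\<^sub>R y) = r *\<^sub>R ip H x y"
  by (metis conjg_of_real ip_smul_right scaleR_conv_of_real smul_of_real)

lemma ip_zero_left: "ip H 0 y = 0"
  using ip_scaleR_left[of 0 0 y] by simp

lemma ip_zero_right: "ip H y 0 = 0"
  using ip_scaleR_right[of y 0 0] by simp

lemma ip_minus_left: "ip H (x - y) z = ip H x z - ip H y z"
  using ip_add_left[of "x - y" y z] by simp

lemma ip_sum_left: "ip H (sum f S) y = (\<Sum>i\<in>S. ip H (f i) y)"
  by (induction S rule: infinite_finite_induct) (simp_all add: ip_zero_left ip_add_left)

lemma ip_sum_right: "ip H y (sum f S) = (\<Sum>i\<in>S. ip H y (f i))"
  by (induction S rule: infinite_finite_induct) (simp_all add: ip_zero_right ip_add_right)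

lemma norm_ip_commute: "norm (ip H x y) = norm (ip H y x)"
  by (metis ip_commute norm_conjg)

lemma ip_eq_zero_commute: "ip H x y = 0 \<longleftrightarrow> ip H y x = 0"
  by (metis norm_ip_commute norm_eq_zero)

lemma norm_smul: "norm (smul H c x) = norm c * norm x"
proof -
  have "ip H (smul H c x) (smul H c x) = (c * conjg c) * ip H x x"
    by (simp add: ip_smul_left ip_smul_right mult_ac)
  then have "of_real ((norm (smul H c x))\<^sup>2) = (of_real ((norm c * norm x)\<^sup>2) :: 'k)"
    by (simp add: ip_self mult_conjg scaleR_conv_of_real power_mult_distrib)
  then show ?thesis
    by (simp only: of_real_eq_iff power2_eq_iff_nonneg norm_ge_zero mult_nonneg_nonneg)
qed

lemma of_real_re_ip: "of_real (2 * re_ip x y) = ip H x y + ip H y x"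
proof -
  have "2 * re_ip x y = (norm (x + y))\<^sup>2 - (norm x)\<^sup>2 - (norm y)\<^sup>2"
    by (simp add: re_ip_def field_simps)
  then show ?thesis
    by (simp only: of_real_diff ip_self[symmetric] ip_add_left ip_add_right) simp
qed

lemma re_ip_eqI:
  assumes "ip H x y + ip H y x = of_real (2 * r)"
  shows "re_ip x y = r"
  using assms of_real_re_ip[of x y] by (metis mult_cancel_left of_real_eq_iff zero_neq_numeral)

lemma bounded_linear_re_ip: "bounded_linear (re_ip (x :: 'a))"
proof (rule bounded_linear_intro)
  show "re_ip x (y + z) = re_ip x y + re_ip x z" for y z
    by (rule re_ip_eqI)
      (simp only: of_real_re_ip distrib_left of_real_add ip_add_left ip_add_right ac_simps)
  show "re_ip x (r *\<^sub>R y) = r *\<^sub>R re_ip x y" for r y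
  proof (rule re_ip_eqI)
    have "ip H x (r *\<^sub>R y) + ip H (r *\<^sub>R y) x = of_real r * of_real (2 * re_ip x y)"
      by (simp only: of_real_re_ip ip_scaleR_left ip_scaleR_right distrib_left scaleR_conv_of_real)
    then show "ip H x (r *\<^sub>R y) + ip H (r *\<^sub>R y) x = of_real (2 * (r *\<^sub>R re_ip x y))"
      by (simp add: mult_ac)
  qed
  show "norm (re_ip x y) \<le> norm y * norm x" for y
    using abs_re_ip_le[of x y] by (simp add: mult.commute)
qed

lemma re_ip_smul_left: "re_ip (smul H c x) y = re_ip x (smul H (conjg c) y)"
  by (rule re_ip_eqI) (simp only: of_real_re_ip ip_smul_left ip_smul_right conjg_conjg)

lemma re_ip_smul_ip: "re_ip x (smul H (ip H x e) e) = (norm (ip H x e))\<^sup>2"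
proof (rule re_ip_eqI)
  have "ip H x (smul H (ip H x e) e) + ip H (smul H (ip H x e) e) x
    = 2 * (ip H x e * conjg (ip H x e))"
    by (simp add: ip_smul_left ip_smul_right ip_commute[of e x])
  then show "ip H x (smul H (ip H x e) e) + ip H (smul H (ip H x e) e) x
    = of_real (2 * (norm (ip H x e))\<^sup>2)"
    by (simp add: mult_conjg scaleR_conv_of_real)
qed

text \<open>
  Multiplying \<open>y\<close> by the scalar \<open>\<langle>x, y\<rangle>\<close> makes the inner product real, which reduces the claim to the
  inequality for \<open>re_ip\<close>.
\<close>

lemma cauchy_schwarz: "norm (ip H x y) \<le> norm x * norm y"
proof (cases "ip H x y = 0")
  case False
  have "(norm (ip H x y))\<^sup>2 \<le> norm x * norm (smul H (ip H x y) y)"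
    using abs_re_ip_le[of x "smul H (ip H x y) y"] by (simp add: re_ip_smul_ip)
  then have "norm (ip H x y) * norm (ip H x y) \<le> norm (ip H x y) * (norm x * norm y)"
    by (simp add: norm_smul power2_eq_square mult_ac)
  then show ?thesis
    using False by simp
qed simp

lemma norm_diff_sq:
  fixes x y :: 'a
  shows "(norm (x - y))\<^sup>2 = (norm x)\<^sup>2 - 2 * re_ip x y + (norm y)\<^sup>2"
proof -
  have "re_ip x (- y) = - re_ip x y"
    by (rule linear_neg[OF bounded_linear.linear[OF bounded_linear_re_ip]])
  then show ?thesis
    using norm_add_sq[of x "- y"] by simp
qed

lemma parallelogram:
  fixes x y :: 'a
  shows "(norm (x + y))\<^sup>2 + (norm (x - y))\<^sup>2 = 2 * (norm x)\<^sup>2 + 2 * (norm y)\<^sup>2"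
  by (simp add: norm_add_sq norm_diff_sq)

lemma norm_midpoint_sq:
  fixes x y :: 'a
  shows "(norm ((1/2) *\<^sub>R (x + y)))\<^sup>2 = ((norm x)\<^sup>2 + (norm y)\<^sup>2) / 2 - (norm (x - y))\<^sup>2 / 4"
  using parallelogram[of x y]
  by (simp only: norm_scaleR power_mult_distrib) (simp add: power_divide field_simps)

lemma bounded_linear_ip_left: "bounded_linear (\<lambda>x. ip H x y)"
  by (rule bounded_linear_intro[where K = "norm y"])
    (simp_all add: ip_add_left ip_scaleR_left cauchy_schwarz)

lemma bounded_linear_ip_right: "bounded_linear (ip H x)"
  by (rule bounded_linear_intro[where K = "norm x"])
    (simp_all add: ip_add_right ip_scaleR_right cauchy_schwarz mult.commute[of _ "norm x"])

end

section \<open>Orthonormal systems and Fourier expansion\<close>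

context hilbert_space
begin

lemma norm_sum_orthonormal:
  assumes "orthonormal H E" "finite S" "S \<subseteq> E"
  shows "(norm (\<Sum>e\<in>S. smul H (a e) e))\<^sup>2 = (\<Sum>e\<in>S. (norm (a e))\<^sup>2)"
  using assms(2,3)
proof (induction S)
  case (insert e S)
  have ip: "ip H e e' = 0" "ip H e' e = 0" if "e' \<in> S" for e'
    using assms(1) insert.hyps insert.prems that unfolding orthonormal_def by auto
  have "ip H e e = 1"
    using assms(1) insert.prems by (simp add: orthonormal_def)
  then have "norm e = 1"
    by (metis ip_self norm_ge_zero of_real_1 of_real_eq_iff one_power2 power2_eq_iff_nonneg zero_le_one)
  moreover
  have "re_ip (smul H (a e) e) (\<Sum>e\<in>S. smul H (a e) e) = 0"
    using insert.hyps ip by (intro re_ip_eqI)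
      (auto simp: ip_smul_left ip_smul_right ip_sum_left ip_sum_right)
  ultimately show ?case
    using insert by (simp add: norm_add_sq norm_smul)
qed simp

lemma id_in_bops: "id_blinfun \<in> bops H H"
  by (simp add: bops_def)

text \<open>
  Bessel's inequality for the functional \<open>\<langle>Y \<cdot>, w\<rangle>\<close>: apply it to the vector \<open>v\<close> whose coefficients are
  the conjugates of its own values on the system. The case of the identity operator is the usual
  inequality.
\<close>

lemma bessel_bops:
  fixes F :: "('k, 'f::banach) hilbert"
  assumes F: "hilbert_space F" and E: "orthonormal H E" and Y: "Y \<in> bops H F"
    and S: "finite S" "S \<subseteq> E"
  shows "(\<Sum>e\<in>S. (norm (ip F (blinfun_apply Y e) w))\<^sup>2) \<le> (norm Y * norm w)\<^sup>2" (is "?s \<le> _")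
proof -
  interpret F: hilbert_space F by fact
  let ?\<alpha> = "\<lambda>e. ip F (blinfun_apply Y e) w"
  define v where "v = (\<Sum>e\<in>S. smul H (conjg (?\<alpha> e)) e)"
  have "(norm v)\<^sup>2 = ?s"
    unfolding v_def by (simp add: norm_sum_orthonormal[OF E S] norm_conjg)
  have "ip F (blinfun_apply Y v) w = (\<Sum>e\<in>S. ?\<alpha> e * conjg (?\<alpha> e))"
    using Y by (simp add: v_def blinfun.sum_right bops_def F.ip_sum_left F.ip_smul_left mult.commute)
  also have "\<dots> = of_real ?s"
    by (simp add: mult_conjg scaleR_conv_of_real)
  finally have ip_Yv: "ip F (blinfun_apply Y v) w = of_real ?s" .
  have "?s = norm (ip F (blinfun_apply Y v) w)"
    unfolding ip_Yv norm_of_real by (simp add: sum_nonneg)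
  also have "\<dots> \<le> norm (blinfun_apply Y v) * norm w"
    by (rule F.cauchy_schwarz)
  also have "\<dots> \<le> (norm Y * norm v) * norm w"
    by (intro mult_right_mono norm_blinfun) simp
  finally have "(norm v)\<^sup>2 \<le> (norm Y * norm w) * norm v"
    using \<open>(norm v)\<^sup>2 = ?s\<close> by (simp add: mult_ac)
  then have "norm v \<le> norm Y * norm w"
    by (cases "norm v = 0") (simp_all add: power2_eq_square)
  then show ?thesis
    using \<open>(norm v)\<^sup>2 = ?s\<close> by (metis norm_ge_zero power_mono)
qed

lemma bessel:
  assumes "orthonormal H E" "finite S" "S \<subseteq> E"
  shows "(\<Sum>e\<in>S. (norm (ip H x e))\<^sup>2) \<le> (norm x)\<^sup>2"
proof -
  have "(\<Sum>e\<in>S. (norm (ip H e x))\<^sup>2) \<le> (norm (id_blinfun :: 'a \<Rightarrow>\<^sub>L 'a) * norm x)\<^sup>2"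
    using bessel_bops[OF hilbert_space_axioms assms(1) id_in_bops assms(2,3)] by simp
  also have "\<dots> \<le> (1 * norm x)\<^sup>2"
    by (intro power_mono mult_right_mono norm_blinfun_id_le) auto
  finally show ?thesis
    by (simp add: norm_ip_commute[of x])
qed

text \<open>
  By Pythagoras, the squared norms of the blocks of the series are those of a convergent numerical
  series, so the net of its finite partial sums is Cauchy.
\<close>

lemma orthonormal_summable:
  assumes E: "orthonormal H E" and a: "(\<lambda>e. (norm (a e))\<^sup>2) summable_on E"
  shows "(\<lambda>e. smul H (a e) e) summable_on E"
proof -
  let ?f = "\<lambda>e. smul H (a e) e" and ?g = "\<lambda>e. (norm (a e))\<^sup>2"
  have "\<exists>P. eventually P (finite_subsets_at_top E) \<and>
      (\<forall>S S'. P S \<and> P S' \<longrightarrow> dist (sum ?f S) (sum ?f S') < \<epsilon>)" if "\<epsilon> > 0" for \<epsilon> :: real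
  proof -
    have "(\<epsilon>/3)\<^sup>2 > 0" using that by simp
    from infsum_finite_approximation[OF a this]
    obtain T where T: "finite T" "T \<subseteq> E" and d: "dist (sum ?g T) (infsum ?g E) \<le> (\<epsilon>/3)\<^sup>2"
      by blast
    have near: "dist (sum ?f S) (sum ?f T) \<le> \<epsilon>/3" if S: "finite S" "T \<subseteq> S" "S \<subseteq> E" for S
    proof -
      have "(norm (sum ?f (S - T)))\<^sup>2 = sum ?g (S - T)"
        by (rule norm_sum_orthonormal[OF E]) (use S in auto)
      also have "\<dots> = sum ?g S - sum ?g T"
        using S by (simp add: sum_diff)
      also have "\<dots> \<le> infsum ?g E - sum ?g T"
        using S by (intro diff_right_mono finite_sum_le_infsum[OF a]) auto
      also have "\<dots> \<le> (\<epsilon>/3)\<^sup>2"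
        using d by (simp add: dist_real_def)
      finally have "norm (sum ?f (S - T)) \<le> \<epsilon>/3"
        using \<open>\<epsilon> > 0\<close> by (simp add: power2_le_iff_abs_le)
      then show ?thesis
        using S T by (simp add: dist_norm sum_diff)
    qed
    define P where "P S \<longleftrightarrow> finite S \<and> T \<subseteq> S \<and> S \<subseteq> E" for S
    have "eventually P (finite_subsets_at_top E)"
      unfolding eventually_finite_subsets_at_top P_def using T by (intro exI[of _ T]) auto
    moreover have "dist (sum ?f S) (sum ?f S') < \<epsilon>" if "P S" "P S'" for S S'
    proof -
      have "dist (sum ?f S) (sum ?f T) \<le> \<epsilon>/3" "dist (sum ?f S') (sum ?f T) \<le> \<epsilon>/3"
        using that near by (auto simp: P_def)
      then show ?thesis
        using \<open>\<epsilon> > 0\<close> dist_triangle2[of "sum ?f S" "sum ?f S'" "sum ?f T"] by linarith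
    qed
    ultimately show ?thesis
      by blast
  qed
  then have "cauchy_filter (filtermap (sum ?f) (finite_subsets_at_top E))"
    by (simp add: cauchy_filter_metric_filtermap)
  moreover have "complete (UNIV::'a set)"
    by (meson Cauchy_convergent UNIV_I complete_def convergent_def)
  ultimately obtain L where "(sum ?f \<longlongrightarrow> L) (finite_subsets_at_top E)"
    using complete_uniform[where S = UNIV] by (force simp add: filterlim_def)
  then show ?thesis
    using summable_on_def has_sum_def by blast
qed

lemma fourier_summable:
  assumes "orthonormal H E"
  shows "(\<lambda>e. smul H (ip H x e) e) summable_on E"
proof (rule orthonormal_summable[OF assms])
  show "(\<lambda>e. (norm (ip H x e))\<^sup>2) summable_on E"
  proof (rule nonneg_bdd_above_summable_on)
    show "bdd_above (sum (\<lambda>e. (norm (ip H x e))\<^sup>2) ` {S. S \<subseteq> E \<and> finite S})"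
      using bessel[OF assms] by (intro bdd_aboveI[of _ "(norm x)\<^sup>2"]) auto
  qed simp
qed

lemma fourier_residual_orthogonal:
  assumes E: "orthonormal H E" and p: "((\<lambda>e. smul H (ip H x e) e) has_sum p) E" and e: "e \<in> E"
  shows "ip H (x - p) e = 0"
proof -
  have "((\<lambda>e'. ip H (smul H (ip H x e') e') e) has_sum ip H p e) E"
    by (rule has_sum_bounded_linear[OF bounded_linear_ip_left p])
  moreover have "((\<lambda>e'. ip H (smul H (ip H x e') e') e) has_sum ip H x e) E"
    using E e by (intro has_sum_finite_neutralI[of "{e}"]) (auto simp: orthonormal_def ip_smul_left)
  ultimately show ?thesis
    using has_sum_unique by (force simp: ip_minus_left)
qed

text \<open>
  A maximal orthonormal system is dense: otherwise the residual of the Fourier series of a vector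
  outside the closed span could be normalised and added to the system.
\<close>

lemma orthonormal_basis_exists: "\<exists>E. orthonormal_basis H E"
proof -
  have "\<exists>M\<in>Collect (orthonormal H). \<forall>E\<in>Collect (orthonormal H). M \<subseteq> E \<longrightarrow> E = M"
  proof (rule subset_Zorn')
    fix \<C> assume "subset.chain (Collect (orthonormal H)) \<C>"
    then have \<C>: "\<And>E. E \<in> \<C> \<Longrightarrow> orthonormal H E" "\<And>E E'. E \<in> \<C> \<Longrightarrow> E' \<in> \<C> \<Longrightarrow> E \<subseteq> E' \<or> E' \<subseteq> E"
      by (auto simp: subset_chain_def)
    have "ip H x y = (if x = y then 1 else 0)" if "x \<in> \<Union>\<C>" "y \<in> \<Union>\<C>" for x y
    proof -
      obtain E where "E \<in> \<C>" "x \<in> E" "y \<in> E"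
        using \<open>x \<in> \<Union>\<C>\<close> \<open>y \<in> \<Union>\<C>\<close> \<C>(2) by blast
      then show ?thesis
        using \<C>(1) by (simp add: orthonormal_def)
    qed
    then show "\<Union>\<C> \<in> Collect (orthonormal H)"
      by (simp add: orthonormal_def)
  qed
  then obtain M where M: "orthonormal H M" and maxi: "\<And>E. orthonormal H E \<Longrightarrow> M \<subseteq> E \<Longrightarrow> E = M"
    by auto
  have "x \<in> closure (vs.span M)" for x
  proof (rule ccontr)
    assume x: "x \<notin> closure (vs.span M)"
    obtain p where p: "((\<lambda>e. smul H (ip H x e) e) has_sum p) M"
      using fourier_summable[OF M] summable_on_def by blast
    have "p \<in> closure (vs.span M)"
      unfolding closure_approachable
    proof (intro allI impI)
      fix \<epsilon> :: real assume "\<epsilon> > 0"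
      then obtain S where "S \<subseteq> M" "dist (\<Sum>e\<in>S. smul H (ip H x e) e) p \<le> \<epsilon>/2"
        using has_sum_finite_approximation[OF p, of "\<epsilon>/2"] by auto
      moreover have "(\<Sum>e\<in>S. smul H (ip H x e) e) \<in> vs.span M"
        using \<open>S \<subseteq> M\<close> by (intro vs.span_sum vs.span_scale vs.span_base) auto
      ultimately show "\<exists>y\<in>vs.span M. dist y p < \<epsilon>"
        using \<open>\<epsilon> > 0\<close> by force
    qed
    then have "x - p \<noteq> 0"
      using x by auto
    define u where "u = (1 / norm (x - p)) *\<^sub>R (x - p)"
    have ort: "ip H u e = 0" "ip H e u = 0" if "e \<in> M" for e
      using fourier_residual_orthogonal[OF M p that] ip_eq_zero_commute[of e u]
      by (simp_all add: u_def ip_scaleR_left)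
    have "ip H u u = 1"
      using \<open>x - p \<noteq> 0\<close> by (simp add: ip_self u_def)
    then have "orthonormal H (insert u M)" "u \<notin> M"
      using M ort by (auto simp: orthonormal_def)
    then show False
      using maxi by blast
  qed
  then show ?thesis
    using M unfolding orthonormal_basis_def orthonormal_def by blast
qed

text \<open>
  The residual of the Fourier series is orthogonal to the basis, hence to the closure of its span,
  which contains the residual itself.
\<close>

lemma fourier_expansion:
  assumes "orthonormal_basis H E"
  shows "((\<lambda>e. smul H (ip H x e) e) has_sum x) E"
proof -
  have E: "orthonormal H E" and dense: "closure (vs.span E) = UNIV"
    using assms unfolding orthonormal_basis_def orthonormal_def by blast+
  obtain p where p: "((\<lambda>e. smul H (ip H x e) e) has_sum p) E"
    using fourier_summable[OF E] summable_on_def by blast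
  let ?N = "{y. ip H y (x - p) = 0}"
  have "vs.span E \<subseteq> ?N"
    using fourier_residual_orthogonal[OF E p] ip_eq_zero_commute[of "x - p"]
    by (intro vs.span_minimal vs.subspaceI) (auto simp: ip_zero_left ip_add_left ip_smul_left)
  moreover have "closed ?N"
    by (intro closed_Collect_eq continuous_on_const
        linear_continuous_on[OF bounded_linear_ip_left])
  ultimately have "closure (vs.span E) \<subseteq> ?N"
    by (rule closure_minimal)
  then have "ip H (x - p) (x - p) = 0"
    using dense by blast
  then show ?thesis
    using p by (simp add: ip_self)
qed

lemma parseval:
  assumes "orthonormal_basis H E"
  shows "((\<lambda>e. (norm (ip H x e))\<^sup>2) has_sum (norm x)\<^sup>2) E"
proof -
  have "((\<lambda>e. re_ip x (smul H (ip H x e) e)) has_sum re_ip x x) E"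
    by (rule has_sum_bounded_linear[OF bounded_linear_re_ip fourier_expansion[OF assms]])
  then show ?thesis
    by (simp only: re_ip_smul_ip re_ip_self)
qed

end

section \<open>Hilbert-Schmidt operators\<close>

lemma bops_diff:
  assumes F: "hilbert_space F" and "X \<in> bops H F" "Y \<in> bops H F"
  shows "X - Y \<in> bops H F"
proof -
  interpret F: hilbert_space F by fact
  show ?thesis
    using assms(2,3) by (simp add: bops_def blinfun.diff_left F.vs.scale_right_diff_distrib)
qed

lemma bops_compose: "\<lbrakk>R \<in> bops F F; X \<in> bops H F\<rbrakk> \<Longrightarrow> R o\<^sub>L X \<in> bops H F"
  by (simp add: bops_def)

lemma has_sum_finite_sum:
  fixes f :: "'i \<Rightarrow> 'a \<Rightarrow> 'b::topological_comm_monoid_add"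
  assumes "\<And>i. i \<in> S \<Longrightarrow> (f i has_sum a i) A"
  shows "((\<lambda>x. \<Sum>i\<in>S. f i x) has_sum (\<Sum>i\<in>S. a i)) A"
  using assms by (induction S rule: infinite_finite_induct) (auto intro: has_sum_add)

context hilbert_space
begin

text \<open>
  The vector \<open>w\<close> is the value at \<open>g\<close> of the adjoint of \<open>X\<close>. Bessel's inequality for \<open>\<langle>X \<cdot>, g\<rangle>\<close> makes
  its Fourier series converge.
\<close>

lemma adjoint_vector:
  fixes F :: "('k, 'f::banach) hilbert"
  assumes F: "hilbert_space F" and B: "orthonormal_basis H B" and X: "X \<in> bops H F"
  obtains w where "\<And>y. ip F (blinfun_apply X y) g = ip H y w"
proof -
  interpret F: hilbert_space F by fact
  have orth: "orthonormal H B"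
    by (rule orthonormal_basisD[OF B])
  let ?c = "\<lambda>f. ip F (blinfun_apply X f) g"
  have "(\<lambda>f. (norm (?c f))\<^sup>2) summable_on B"
  proof (rule nonneg_bdd_above_summable_on)
    show "bdd_above (sum (\<lambda>f. (norm (?c f))\<^sup>2) ` {S. S \<subseteq> B \<and> finite S})"
      using bessel_bops[OF F orth X] by (intro bdd_aboveI[of _ "(norm X * norm g)\<^sup>2"]) auto
  qed simp
  then obtain w where w: "((\<lambda>f. smul H (conjg (?c f)) f) has_sum w) B"
    using orthonormal_summable[OF orth, of "\<lambda>f. conjg (?c f)"]
    by (auto simp: norm_conjg summable_on_def)
  have "ip F (blinfun_apply X y) g = ip H y w" for y
  proof -
    have "((\<lambda>f. ip H y (smul H (conjg (?c f)) f)) has_sum ip H y w) B"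
      by (rule has_sum_bounded_linear[OF bounded_linear_ip_right w])
    moreover have "bounded_linear (\<lambda>y. ip F (blinfun_apply X y) g)"
      by (rule bounded_linear_compose[OF F.bounded_linear_ip_left blinfun.bounded_linear_right])
    then have "((\<lambda>f. ip F (blinfun_apply X (smul H (ip H y f) f)) g)
        has_sum ip F (blinfun_apply X y) g) B"
      by (rule has_sum_bounded_linear[OF _ fourier_expansion[OF B]])
    moreover have "ip F (blinfun_apply X (smul H (ip H y f) f)) g = ip H y (smul H (conjg (?c f)) f)"
      for f
      using X by (simp add: bops_def F.ip_smul_left ip_smul_right conjg_conjg mult.commute)
    ultimately show ?thesis
      using has_sum_unique by force
  qed
  then show thesis
    using that by blast
qed

end

text \<open>
  Expand \<open>R (Y e)\<close> in a basis \<open>B\<close> of \<open>F\<close>, exchange the sums, and apply Bessel's inequality to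
  \<open>\<langle>R (Y \<cdot>), g\<rangle> = \<langle>Y \<cdot>, R* g\<rangle>\<close> for each \<open>g\<close> in \<open>B\<close>. What remains is the sum of \<open>\<parallel>R* g\<parallel>\<^sup>2\<close>, which a second
  exchange bounds by the sum of \<open>\<parallel>R f\<parallel>\<^sup>2\<close>. With finite partial sums on one side of each exchange, no
  double series occurs.
\<close>

lemma hilbert_schmidt_comp_summable:
  fixes H :: "('k::rc_field, 'h::banach) hilbert" and F :: "('k, 'f::banach) hilbert"
  assumes H: "hilbert_space H" and F: "hilbert_space F" and R: "R \<in> hilbert_schmidt F F"
    and Y: "Y \<in> bops H F" and E: "orthonormal H E"
  shows "(\<lambda>e. (norm (blinfun_apply R (blinfun_apply Y e)))\<^sup>2) summable_on E"
proof -
  interpret H: hilbert_space H by fact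
  interpret F: hilbert_space F by fact
  obtain B where B: "orthonormal_basis F B"
    and RB: "(\<lambda>f. (norm (blinfun_apply R f))\<^sup>2) summable_on B" and "R \<in> bops F F"
    using R by (auto simp: hilbert_schmidt_def)
  have orth: "orthonormal F B"
    by (rule orthonormal_basisD[OF B])
  define C where "C = (\<Sum>\<^sub>\<infinity>f\<in>B. (norm (blinfun_apply R f))\<^sup>2)"
  have "\<exists>w. \<forall>y. ip F (blinfun_apply R y) g = ip F y w" for g
    using F.adjoint_vector[OF F B \<open>R \<in> bops F F\<close>] by metis
  then obtain w where w: "\<And>g y. ip F (blinfun_apply R y) g = ip F y (w g)"
    by metis
  \<comment> \<open>\<open>w g\<close> is the value of the adjoint of \<open>R\<close> at \<open>g\<close>, so this bounds
    the Hilbert-Schmidt norm of that adjoint.\<close>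
  have w_le: "(\<Sum>g\<in>T. (norm (w g))\<^sup>2) \<le> C" if "finite T" "T \<subseteq> B" for T
  proof (rule has_sum_mono)
    have "((\<lambda>f. (norm (ip F f (w g)))\<^sup>2) has_sum (norm (w g))\<^sup>2) B" for g
      using F.parseval[OF B, of "w g"] by (simp add: F.norm_ip_commute[of "w g"])
    then show "((\<lambda>f. \<Sum>g\<in>T. (norm (ip F f (w g)))\<^sup>2) has_sum (\<Sum>g\<in>T. (norm (w g))\<^sup>2)) B"
      by (rule has_sum_finite_sum)
    show "((\<lambda>f. (norm (blinfun_apply R f))\<^sup>2) has_sum C) B"
      unfolding C_def by (rule has_sum_infsum[OF RB])
    show "(\<Sum>g\<in>T. (norm (ip F f (w g)))\<^sup>2) \<le> (norm (blinfun_apply R f))\<^sup>2" for f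
      using F.bessel[OF orth that] by (simp add: w[symmetric])
  qed
  have "(\<Sum>e\<in>S. (norm (blinfun_apply R (blinfun_apply Y e)))\<^sup>2) \<le> (norm Y)\<^sup>2 * C"
    if S: "finite S" "S \<subseteq> E" for S
  proof (rule has_sum_le_finite_sums)
    let ?a = "\<lambda>e g. (norm (ip F (blinfun_apply R (blinfun_apply Y e)) g))\<^sup>2"
    show "((\<lambda>g. \<Sum>e\<in>S. ?a e g) has_sum
        (\<Sum>e\<in>S. (norm (blinfun_apply R (blinfun_apply Y e)))\<^sup>2)) B"
      by (rule has_sum_finite_sum) (rule F.parseval[OF B])
    fix T assume T: "finite T" "T \<subseteq> B"
    have "(\<Sum>g\<in>T. \<Sum>e\<in>S. ?a e g) \<le> (\<Sum>g\<in>T. (norm Y * norm (w g))\<^sup>2)"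
      unfolding w by (intro sum_mono H.bessel_bops[OF F E Y S])
    also have "\<dots> = (norm Y)\<^sup>2 * (\<Sum>g\<in>T. (norm (w g))\<^sup>2)"
      by (simp add: power_mult_distrib sum_distrib_left)
    also have "\<dots> \<le> (norm Y)\<^sup>2 * C"
      using w_le[OF T] by (intro mult_left_mono) auto
    finally show "(\<Sum>g\<in>T. \<Sum>e\<in>S. ?a e g) \<le> (norm Y)\<^sup>2 * C" .
  qed
  then show ?thesis
    by (intro nonneg_bdd_above_summable_on bdd_aboveI[of _ "(norm Y)\<^sup>2 * C"]) auto
qed

lemma some_orthonormal_basis:
  assumes "hilbert_space H"
  shows "orthonormal_basis H (SOME E. orthonormal_basis H E)"
  using someI_ex[OF hilbert_space.orthonormal_basis_exists[OF assms]] .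

lemma hs_norm_sq:
  "(hs_norm H X)\<^sup>2 = (\<Sum>\<^sub>\<infinity>e\<in>(SOME E. orthonormal_basis H E). (norm (blinfun_apply X e))\<^sup>2)"
  by (simp add: hs_norm_def infsum_nonneg)

text \<open>
  With \<open>R\<close> the square root of \<open>W\<close>, the weighted norm vanishes only if \<open>R D\<close> vanishes on a basis, and
  then Fourier expansion makes \<open>R D\<close> vanish everywhere. Summability matters here, as a divergent series also has the value 0.
\<close>

lemma hs_wnorm_eq_0D:
  fixes H :: "('k::rc_field, 'h::banach) hilbert" and F :: "('k, 'f::banach) hilbert"
  assumes H: "hilbert_space H" and F: "hilbert_space F"
    and HS: "op_sqrt F W \<in> hilbert_schmidt F F" and D: "D \<in> bops H F" and 0: "hs_wnorm H F W D = 0"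
  shows "wnorm F W (blinfun_apply D v) = 0"
proof -
  interpret H: hilbert_space H by fact
  interpret F: hilbert_space F by fact
  define R where "R = op_sqrt F W"
  have RD: "R o\<^sub>L D \<in> bops H F"
    using HS D by (intro bops_compose) (simp_all add: R_def hilbert_schmidt_def)
  define E where "E = (SOME E. orthonormal_basis H E)"
  have E: "orthonormal_basis H E"
    unfolding E_def by (rule some_orthonormal_basis[OF H])
  have "(\<Sum>\<^sub>\<infinity>e\<in>E. (norm (blinfun_apply R (blinfun_apply D e)))\<^sup>2) = 0"
    using 0 hs_norm_sq[of H "R o\<^sub>L D"] by (simp add: hs_wnorm_def R_def E_def)
  moreover have "(\<lambda>e. (norm (blinfun_apply R (blinfun_apply D e)))\<^sup>2) summable_on E"
    unfolding R_def by (rule hilbert_schmidt_comp_summable[OF H F HS D orthonormal_basisD[OF E]])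
  ultimately have "(norm (blinfun_apply R (blinfun_apply D e)))\<^sup>2 = 0" if "e \<in> E" for e
    using that by (intro nonneg_infsum_le_0D) auto
  then have zero: "blinfun_apply (R o\<^sub>L D) (smul H c e) = 0" if "e \<in> E" for c e
    using RD that by (simp add: bops_def)
  have "((\<lambda>e. blinfun_apply (R o\<^sub>L D) (smul H (ip H v e) e)) has_sum blinfun_apply (R o\<^sub>L D) v) E"
    by (rule has_sum_bounded_linear[OF blinfun.bounded_linear_right H.fourier_expansion[OF E]])
  then have "((\<lambda>e. 0) has_sum blinfun_apply (R o\<^sub>L D) v) E"
    using has_sum_cong[of E "\<lambda>e. blinfun_apply (R o\<^sub>L D) (smul H (ip H v e) e)" "\<lambda>e. 0"] zero by simp
  then have "blinfun_apply (R o\<^sub>L D) v = 0"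
    using has_sum_unique has_sum_0_simp by blast
  then show ?thesis
    by (simp add: wnorm_def R_def)
qed

section \<open>Completing the square in the operator variable\<close>

definition rank_one ::
  "('k::rc_field, 'h::banach) hilbert \<Rightarrow> ('k, 'f::banach) hilbert \<Rightarrow> 'f \<Rightarrow> 'h \<Rightarrow> ('h \<Rightarrow>\<^sub>L 'f)"
  where "rank_one H F u x = Blinfun (\<lambda>v. smul F (ip H v x) u)"

lemma rank_one_apply:
  assumes H: "hilbert_space H" and F: "hilbert_space F"
  shows "blinfun_apply (rank_one H F u x) v = smul F (ip H v x) u"
proof -
  interpret H: hilbert_space H by fact
  interpret F: hilbert_space F by fact
  have "bounded_linear (\<lambda>v. smul F (ip H v x) u)"
  proof (rule bounded_linear_intro)
    show "smul F (ip H (r *\<^sub>R v) x) u = r *\<^sub>R smul F (ip H v x) u" for r v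
      by (metis F.vs.scale_scale H.ip_scaleR_left F.smul_of_real scaleR_conv_of_real)
    show "norm (smul F (ip H v x) u) \<le> norm v * (norm x * norm u)" for v
      using mult_right_mono[OF H.cauchy_schwarz[of v x], of "norm u"]
      by (simp add: F.norm_smul mult.assoc)
  qed (simp add: H.ip_add_left F.vs.scale_left_distrib)
  then show ?thesis
    by (simp add: rank_one_def bounded_linear_Blinfun_apply)
qed

lemma rank_one_in_bops:
  assumes H: "hilbert_space H" and F: "hilbert_space F"
  shows "rank_one H F u x \<in> bops H F"
proof -
  interpret H: hilbert_space H by fact
  interpret F: hilbert_space F by fact
  show ?thesis
    by (simp add: bops_def rank_one_apply[OF H F] H.ip_smul_left)
qed

text \<open>
  The cross term is the Hilbert-Schmidt inner product of \<open>\<langle>\<cdot>, x\<rangle> u\<close> and \<open>D\<close>; moving the coefficient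
  \<open>\<langle>e, x\<rangle>\<close> to the other side turns it into \<open>Re \<langle>u, D (\<Sum> \<langle>x, e\<rangle> e)\<rangle>\<close>, and the argument of \<open>D\<close> sums to
  \<open>x\<close>.
\<close>

lemma sum_sq_rank_one_add:
  fixes H :: "('k::rc_field, 'h::banach) hilbert" and F :: "('k, 'f::banach) hilbert"
  assumes H: "hilbert_space H" and F: "hilbert_space F" and E: "orthonormal_basis H E"
    and D: "D \<in> bops H F" and sumD: "(\<lambda>e. (norm (blinfun_apply D e))\<^sup>2) summable_on E"
  shows "(\<Sum>\<^sub>\<infinity>e\<in>E. (norm (smul F (ip H e x) u + blinfun_apply D e))\<^sup>2) =
    (norm x * norm u)\<^sup>2 + 2 * re_ip u (blinfun_apply D x) + (\<Sum>\<^sub>\<infinity>e\<in>E. (norm (blinfun_apply D e))\<^sup>2)"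
proof -
  interpret H: hilbert_space H by fact
  interpret F: hilbert_space F by fact
  let ?c = "\<lambda>e. re_ip u (blinfun_apply D (smul H (ip H x e) e))"
  have expand: "(norm (smul F (ip H e x) u + blinfun_apply D e))\<^sup>2 =
      (norm (ip H x e))\<^sup>2 * (norm u)\<^sup>2 + 2 * ?c e + (norm (blinfun_apply D e))\<^sup>2" for e
  proof -
    have "re_ip (smul F (ip H e x) u) (blinfun_apply D e) = ?c e"
      using D by (simp add: F.re_ip_smul_left bops_def H.ip_commute[of x e])
    then show ?thesis
      by (simp add: norm_add_sq F.norm_smul power_mult_distrib H.norm_ip_commute[of e x])
  qed
  have "((\<lambda>e. (norm (ip H x e))\<^sup>2 * (norm u)\<^sup>2) has_sum (norm x)\<^sup>2 * (norm u)\<^sup>2) E"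
    by (intro has_sum_cmult_left H.parseval[OF E])
  moreover have "((\<lambda>e. 2 * ?c e) has_sum 2 * re_ip u (blinfun_apply D x)) E"
  proof (intro has_sum_cmult_right)
    show "(?c has_sum re_ip u (blinfun_apply D x)) E"
      by (rule has_sum_bounded_linear[OF bounded_linear_compose[OF F.bounded_linear_re_ip
              blinfun.bounded_linear_right] H.fourier_expansion[OF E]])
  qed
  ultimately have "((\<lambda>e. (norm (ip H x e))\<^sup>2 * (norm u)\<^sup>2 + 2 * ?c e + (norm (blinfun_apply D e))\<^sup>2)
      has_sum (norm x)\<^sup>2 * (norm u)\<^sup>2 + 2 * re_ip u (blinfun_apply D x)
        + (\<Sum>\<^sub>\<infinity>e\<in>E. (norm (blinfun_apply D e))\<^sup>2)) E"
    using sumD by (intro has_sum_add has_sum_infsum)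
  then show ?thesis
    by (simp only: expand power_mult_distrib infsumI)
qed

text \<open>
  For fixed \<open>x\<close>, the operator part of the objective is quadratic in \<open>X\<close>, and this is a stationary
  point: a rank-one correction of \<open>A\<close> splits the residual \<open>A x - b\<close> between the two quadratic terms
  in the ratio \<open>\<parallel>x\<parallel>\<^sup>2 : 1\<close>.
\<close>

definition optimal_operator ::
  "('k::rc_field, 'h::banach) hilbert \<Rightarrow> ('k, 'f::banach) hilbert \<Rightarrow> ('h \<Rightarrow>\<^sub>L 'f) \<Rightarrow> 'f \<Rightarrow> 'h \<Rightarrow> ('h \<Rightarrow>\<^sub>L 'f)"
  where "optimal_operator H F A b x =
    A - rank_one H F ((1 / (1 + (norm x)\<^sup>2)) *\<^sub>R (blinfun_apply A x - b)) x"

text \<open>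
  With \<open>D = R (Z - X)\<close> and \<open>u = R q\<close>, the cross terms \<open>\<plusminus> 2 Re \<langle>u, D x\<rangle>\<close> of the two squares cancel, so that the remainder
  \<open>\<parallel>D\<parallel>\<^sub>2\<^sup>2 + \<parallel>D x\<parallel>\<^sup>2\<close> is nonnegative and the minimum over \<open>X\<close> can be read off.
\<close>

lemma rtls_objective_eq:
  fixes H :: "('k::rc_field, 'h::banach) hilbert" and F :: "('k, 'f::banach) hilbert"
  assumes H: "hilbert_space H" and F: "hilbert_space F" and A: "A \<in> bops H F"
    and HS: "op_sqrt F W \<in> hilbert_schmidt F F" and "\<rho> \<ge> 0" and X: "X \<in> bops H F"
  shows "rtls_objective H F A b W (sqrt \<rho> *\<^sub>R id_blinfun) (X, x) =
    G_fun F A b W \<rho> x + (hs_wnorm H F W (X - optimal_operator H F A b x))\<^sup>2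
      + (wnorm F W (blinfun_apply (X - optimal_operator H F A b x) x))\<^sup>2"
proof -
  interpret H: hilbert_space H by fact
  interpret F: hilbert_space F by fact
  define R where "R = op_sqrt F W"
  have R: "R \<in> bops F F"
    using HS by (simp add: R_def hilbert_schmidt_def)
  define E where "E = (SOME E. orthonormal_basis H E)"
  have E: "orthonormal_basis H E"
    unfolding E_def by (rule some_orthonormal_basis[OF H])
  define s where "s = 1 + (norm x)\<^sup>2"
  have "s > 0"
    by (simp add: s_def add_pos_nonneg)
  define q where "q = (1 / s) *\<^sub>R (blinfun_apply A x - b)"
  have sq: "s *\<^sub>R q = blinfun_apply A x - b"
    using \<open>s > 0\<close> by (simp add: q_def)
  define u where "u = blinfun_apply R q"
  define Z where "Z = optimal_operator H F A b x"
  have Z: "Z = A - rank_one H F q x"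
    by (simp add: Z_def optimal_operator_def q_def s_def)
  define D where "D = R o\<^sub>L (Z - X)"
  have ZX: "Z - X \<in> bops H F"
    unfolding Z by (intro bops_diff F A X rank_one_in_bops H)
  have D: "D \<in> bops H F"
    unfolding D_def by (intro bops_compose R ZX)
  have sumD: "(\<lambda>e. (norm (blinfun_apply D e))\<^sup>2) summable_on E"
    using hilbert_schmidt_comp_summable[OF H F HS ZX orthonormal_basisD[OF E]]
    by (simp add: D_def R_def)
  have "blinfun_apply (R o\<^sub>L (A - X)) e = smul F (ip H e x) u + blinfun_apply D e" for e
  proof -
    have "blinfun_apply (A - X) e = smul F (ip H e x) q + blinfun_apply (Z - X) e"
      by (simp add: Z rank_one_apply[OF H F] blinfun.diff_left)
    then show ?thesis
      using R by (simp add: D_def u_def blinfun.add_right bops_def)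
  qed
  then have hs: "(hs_wnorm H F W (A - X))\<^sup>2 =
      (norm x * norm u)\<^sup>2 + 2 * re_ip u (blinfun_apply D x) + (hs_norm H D)\<^sup>2"
    unfolding hs_wnorm_def hs_norm_sq R_def[symmetric] E_def[symmetric]
    by (simp only: sum_sq_rank_one_add[OF H F E D sumD])
  have "smul F (ip H x x) q = (norm x)\<^sup>2 *\<^sub>R q"
    by (simp add: H.ip_self F.smul_of_real del: of_real_power)
  then have "blinfun_apply Z x = blinfun_apply A x - (norm x)\<^sup>2 *\<^sub>R q"
    by (simp add: Z rank_one_apply[OF H F] blinfun.diff_left)
  then have "blinfun_apply Z x - b = s *\<^sub>R q - (norm x)\<^sup>2 *\<^sub>R q"
    unfolding sq by simp
  also have "\<dots> = q"
    by (simp add: s_def scaleR_add_left)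
  finally have "blinfun_apply X x - b = q - blinfun_apply (Z - X) x"
    by (simp add: blinfun.diff_left algebra_simps)
  then have w: "(wnorm F W (blinfun_apply X x - b))\<^sup>2 =
      (norm u)\<^sup>2 - 2 * re_ip u (blinfun_apply D x) + (norm (blinfun_apply D x))\<^sup>2"
    by (simp add: wnorm_def R_def[symmetric] D_def u_def blinfun.diff_right F.norm_diff_sq)
  have "(wnorm F W (blinfun_apply A x - b))\<^sup>2 = s\<^sup>2 * (norm u)\<^sup>2"
    using \<open>s > 0\<close>
    by (simp add: wnorm_def R_def[symmetric] sq[symmetric] u_def blinfun.scaleR_right power_mult_distrib)
  then have G: "G_fun F A b W \<rho> x = s * (norm u)\<^sup>2 + \<rho> * (norm x)\<^sup>2"
    using \<open>s > 0\<close> unfolding G_fun_def s_def[symmetric] by (simp add: power2_eq_square)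
  have D_uminus: "R o\<^sub>L (X - Z) = - D"
    by (rule blinfun_eqI) (simp add: D_def blinfun.diff_left blinfun.diff_right blinfun.minus_left)
  then have hs_flip: "hs_wnorm H F W (X - Z) = hs_norm H D"
    by (simp add: hs_wnorm_def R_def[symmetric] hs_norm_def blinfun.minus_left)
  have "blinfun_apply R (blinfun_apply (X - Z) x) = - blinfun_apply D x"
    by (simp add: D_def blinfun.diff_left blinfun.diff_right)
  then have w_flip: "wnorm F W (blinfun_apply (X - Z) x) = norm (blinfun_apply D x)"
    by (simp add: wnorm_def R_def[symmetric])
  show ?thesis
    using \<open>\<rho> \<ge> 0\<close> unfolding Z_def[symmetric] rtls_objective_def
    by (simp add: hs w G hs_flip w_flip s_def blinfun.scaleR_left power_mult_distrib algebra_simps)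
qed

section \<open>The reduced problem in the vector variable\<close>

text \<open>
  Although \<open>g\<close> need not be convex, its minimisers are the zeros of \<open>\<Phi> = (1 + \<parallel>\<cdot>\<parallel>\<^sup>2) (g - t)\<close>, where \<open>t\<close> is
  the infimum, and \<open>\<Phi>\<close> is uniformly convex because \<open>t \<le> \<rho>\<close> keeps the coefficient of \<open>\<parallel>x\<parallel>\<^sup>2\<close>
  nonnegative. The estimate \<open>gap\<close> yields both uniqueness and convergence of minimising sequences.
\<close>

lemma fractional_minimum_ex1:
  fixes H :: "('k::rc_field, 'h::banach) hilbert" and F :: "('k, 'f::banach) hilbert"
  assumes H: "hilbert_space H" and F: "hilbert_space F" and K: "bounded_linear (K :: 'h \<Rightarrow> 'f)"
    and "\<rho> > 0"
    and g_def: "\<And>x. g x = (norm (K x - c))\<^sup>2 / (1 + (norm x)\<^sup>2) + \<rho> * (norm x)\<^sup>2"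
    and t_le: "(INF x. g x) \<le> \<rho>"
  shows "\<exists>!x. \<forall>y. g x \<le> g y"
proof -
  interpret H: hilbert_space H by fact
  interpret F: hilbert_space F by fact
  interpret K: bounded_linear K by fact
  define t where "t = (INF x. g x)"
  have nonneg: "0 \<le> g x" for x
    using \<open>\<rho> > 0\<close> by (simp add: g_def)
  have t_min: "t \<le> g x" for x
    unfolding t_def by (intro cINF_lower bdd_belowI2[of _ 0] nonneg) simp
  define \<Phi> where "\<Phi> x = (1 + (norm x)\<^sup>2) * (g x - t)" for x
  have pos: "0 < 1 + (norm x)\<^sup>2" for x :: 'h
    by (simp add: add_pos_nonneg)
  have \<Phi>_nonneg: "0 \<le> \<Phi> x" for x
    unfolding \<Phi>_def using t_min[of x] pos[of x] by (intro mult_nonneg_nonneg) auto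
  have \<Phi>_eq: "\<Phi> x = (norm (K x - c))\<^sup>2 + (\<rho> - t) * (norm x)\<^sup>2 + \<rho> * ((norm x)\<^sup>2)\<^sup>2 - t" for x
  proof -
    have "(1 + (norm x)\<^sup>2) * ((norm (K x - c))\<^sup>2 / (1 + (norm x)\<^sup>2)) = (norm (K x - c))\<^sup>2"
      using pos[of x] by simp
    then show ?thesis
      unfolding \<Phi>_def g_def by (simp add: algebra_simps power2_eq_square)
  qed
  \<comment> \<open>Compare \<open>\<Phi>\<close> at the midpoint \<open>m\<close> with its mean value at \<open>x\<close> and \<open>y\<close>. The gain
    comes from the quartic term, as \<open>\<parallel>m\<parallel>\<^sup>2 + \<parallel>x - y\<parallel>\<^sup>2 / 4\<close> is the mean of \<open>\<parallel>x\<parallel>\<^sup>2\<close> and \<open>\<parallel>y\<parallel>\<^sup>2\<close>.\<close>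
  have gap: "\<rho> * (norm (x - y))^4 \<le> 8 * (\<Phi> x + \<Phi> y)" for x y
  proof -
    define m where "m = (1/2) *\<^sub>R (x + y)"
    define a b d where "a = (norm x)\<^sup>2" and "b = (norm y)\<^sup>2" and "d = (norm (x - y))\<^sup>2"
    have m: "(norm m)\<^sup>2 = (a + b) / 2 - d / 4"
      unfolding m_def a_def b_def d_def by (rule H.norm_midpoint_sq)
    have "K m - c = (1/2) *\<^sub>R ((K x - c) + (K y - c))"
      by (simp add: m_def K.add K.scaleR algebra_simps flip: scaleR_add_left)
    then have "(norm (K m - c))\<^sup>2 = ((norm (K x - c))\<^sup>2 + (norm (K y - c))\<^sup>2) / 2
        - (norm ((K x - c) - (K y - c)))\<^sup>2 / 4"
      by (simp only: F.norm_midpoint_sq)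
    then have Km: "(norm (K m - c))\<^sup>2 \<le> ((norm (K x - c))\<^sup>2 + (norm (K y - c))\<^sup>2) / 2"
      using zero_le_power2[of "norm ((K x - c) - (K y - c))"] by linarith
    have "d \<ge> 0" "(norm m)\<^sup>2 \<ge> 0"
      by (simp_all add: d_def)
    have "(\<rho> - t) * (norm m)\<^sup>2 \<le> (\<rho> - t) * ((a + b) / 2)"
      using t_le \<open>d \<ge> 0\<close> m unfolding t_def[symmetric] by (intro mult_left_mono) linarith+
    moreover have "((norm m)\<^sup>2)\<^sup>2 + d\<^sup>2 / 16 \<le> (a\<^sup>2 + b\<^sup>2) / 2"
    proof -
      have "((norm m)\<^sup>2)\<^sup>2 + d\<^sup>2 / 16 \<le> ((norm m)\<^sup>2 + d / 4)\<^sup>2"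
        using mult_nonneg_nonneg[OF \<open>d \<ge> 0\<close> \<open>(norm m)\<^sup>2 \<ge> 0\<close>]
        by (simp add: power2_sum power_divide mult.commute)
      also have "\<dots> = ((a + b) / 2)\<^sup>2"
        by (simp add: m)
      also have "\<dots> \<le> (a\<^sup>2 + b\<^sup>2) / 2"
        using zero_le_power2[of "a - b"] by (simp add: power2_sum power2_diff power_divide)
      finally show ?thesis .
    qed
    then have "\<rho> * (((norm m)\<^sup>2)\<^sup>2 + d\<^sup>2 / 16) \<le> \<rho> * ((a\<^sup>2 + b\<^sup>2) / 2)"
      using \<open>\<rho> > 0\<close> by simp
    ultimately have "\<Phi> m + \<rho> * d\<^sup>2 / 16 \<le> (\<Phi> x + \<Phi> y) / 2"
      using Km unfolding \<Phi>_eq a_def[symmetric] b_def[symmetric] by (simp add: algebra_simps)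
    then have "\<rho> * d\<^sup>2 \<le> 8 * (\<Phi> x + \<Phi> y)"
      using \<Phi>_nonneg[of m] by simp
    moreover have "d\<^sup>2 = (norm (x - y))^4"
      unfolding d_def by simp
    ultimately show ?thesis by simp
  qed
  have unique: "x = y" if "g x \<le> t" "g y \<le> t" for x y
  proof -
    have "\<Phi> x = 0" "\<Phi> y = 0"
      using that t_min[of x] t_min[of y] by (simp_all add: \<Phi>_def)
    then have "\<rho> * (norm (x - y))^4 \<le> 0"
      using gap[of x y] by simp
    then show ?thesis
      using \<open>\<rho> > 0\<close> by (simp add: mult_le_0_iff)
  qed
  have "\<exists>x. g x < t + 1 / (real n + 1)" for n
  proof -
    have "(INF x. g x) < t + 1 / (real n + 1)"
      unfolding t_def by simp
    then show ?thesis
      using cINF_less_iff[OF UNIV_not_empty bdd_belowI2[of UNIV 0 g]] nonneg by auto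
  qed
  then obtain s where s: "\<And>n. g (s n) < t + 1 / (real n + 1)"
    by metis
  \<comment> \<open>The term \<open>\<rho> \<parallel>x\<parallel>\<^sup>2\<close> of \<open>g\<close> bounds the minimising sequence, so that the factor \<open>1 + \<parallel>x\<parallel>\<^sup>2\<close> in \<open>\<Phi>\<close> is
    harmless along it.\<close>
  define M where "M = 1 + (t + 1) / \<rho>"
  have "1 + (norm (s n))\<^sup>2 \<le> M" for n
  proof -
    have "\<rho> * (norm (s n))\<^sup>2 \<le> g (s n)"
      by (simp add: g_def)
    also have "\<dots> \<le> t + 1"
      using s[of n] by (smt (verit) divide_le_eq_1_pos of_nat_0_le_iff)
    finally show ?thesis
      using \<open>\<rho> > 0\<close> by (simp add: M_def field_simps)
  qed
  note M = this
  have \<Phi>_small: "\<Phi> (s n) \<le> M / (real N + 1)" if "N \<le> n" for n N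
  proof -
    have "g (s n) - t \<le> 1 / (real n + 1)"
      using s[of n] by simp
    also have "\<dots> \<le> 1 / (real N + 1)"
      using that by (intro divide_left_mono) auto
    finally have "g (s n) - t \<le> 1 / (real N + 1)" .
    then have "\<Phi> (s n) \<le> M * (1 / (real N + 1))"
      unfolding \<Phi>_def using M[of n] pos[of "s n"] t_min[of "s n"] by (intro mult_mono) auto
    then show ?thesis by simp
  qed
  have "Cauchy s"
  proof (rule metric_CauchyI)
    fix \<epsilon> :: real assume "\<epsilon> > 0"
    then have "0 < \<rho> * \<epsilon>^4"
      using \<open>\<rho> > 0\<close> by simp
    obtain N :: nat where N: "16 * M / (\<rho> * \<epsilon>^4) < real N"
      using reals_Archimedean2 by blast
    have "dist (s m) (s n) < \<epsilon>" if "m \<ge> N" "n \<ge> N" for m n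
    proof -
      have "\<rho> * (norm (s m - s n))^4 \<le> 16 * M / (real N + 1)"
        using gap[of "s m" "s n"] \<Phi>_small[OF that(1)] \<Phi>_small[OF that(2)] by simp
      also have "\<dots> < \<rho> * \<epsilon>^4"
        using N \<open>0 < \<rho> * \<epsilon>^4\<close> by (simp add: field_simps)
      finally have "(norm (s m - s n))^4 < \<epsilon>^4"
        using \<open>\<rho> > 0\<close> by simp
      then show ?thesis
        using \<open>\<epsilon> > 0\<close> by (simp add: dist_norm power_less_imp_less_base)
    qed
    then show "\<exists>N. \<forall>m\<ge>N. \<forall>n\<ge>N. dist (s m) (s n) < \<epsilon>"
      by blast
  qed
  then obtain x where x: "s \<longlonglongrightarrow> x"
    using Cauchy_convergent convergent_def by blast
  have "(\<lambda>n. g (s n)) \<longlonglongrightarrow> g x"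
    unfolding g_def using pos[of x] by (intro tendsto_intros x K.tendsto) simp
  moreover have "(\<lambda>n. t + 1 / (real n + 1)) \<longlonglongrightarrow> t + 0"
    by (intro tendsto_add tendsto_const) (use LIMSEQ_inverse_real_of_nat in
        \<open>simp add: inverse_eq_divide add.commute\<close>)
  ultimately have "g x \<le> t"
    using s by (intro LIMSEQ_le) (auto intro: less_imp_le)
  then show ?thesis
    using t_min unique by (metis order_trans)
qed

section \<open>Existence and uniqueness of the solution\<close>

theorem corollary4p10:
  fixes H :: "('k::rc_field, 'h::banach) hilbert"
    and F :: "('k, 'f::banach) hilbert"
    and A :: "'h \<Rightarrow>\<^sub>L 'f" and b :: 'f and W :: "'f \<Rightarrow>\<^sub>L 'f" and \<rho> :: real
  assumes "hilbert_space H" and "hilbert_space F"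
    and "A \<in> bops H F"
    and "psd F W" and "op_sqrt F W \<in> hilbert_schmidt F F"
    and "\<rho> > 0"
    and "\<rho> \<ge> (INF x. G_fun F A b W \<rho> x)"
  shows "(\<exists>A0 x0. A0 \<in> bops H F \<and>
          (\<forall>X x. rtls_solution H F A b W (sqrt \<rho> *\<^sub>R id_blinfun) (X, x) \<longleftrightarrow>
            X \<in> bops H F \<and> x = x0 \<and> hs_wnorm H F W (X - A0) = 0)) \<and>
        ((\<forall>z. wnorm F W z = 0 \<longrightarrow> z = 0) \<longrightarrow>
          (\<exists>!p. rtls_solution H F A b W (sqrt \<rho> *\<^sub>R id_blinfun) p))"
proof -
  note H = assms(1) and F = assms(2) and A = assms(3) and HS = assms(5)
  interpret F: hilbert_space F by fact
  let ?J = "rtls_objective H F A b W (sqrt \<rho> *\<^sub>R id_blinfun)"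
  let ?G = "G_fun F A b W \<rho>"
  let ?Z = "optimal_operator H F A b"
  let ?sol = "rtls_solution H F A b W (sqrt \<rho> *\<^sub>R id_blinfun)"
  have Z: "?Z x \<in> bops H F" for x
    unfolding optimal_operator_def by (intro bops_diff F A rank_one_in_bops H)
  have J: "?J (X, x) = ?G x + (hs_wnorm H F W (X - ?Z x))\<^sup>2
      + (wnorm F W (blinfun_apply (X - ?Z x) x))\<^sup>2" if "X \<in> bops H F" for X x
    by (rule rtls_objective_eq[OF H F A HS _ that]) (use \<open>\<rho> > 0\<close> in simp)
  have hs_0: "hs_wnorm H F W 0 = 0"
    by (simp add: hs_wnorm_def hs_norm_def)
  have wnorm_0: "wnorm F W (blinfun_apply (X - ?Z x) v) = 0"
    if "X \<in> bops H F" "hs_wnorm H F W (X - ?Z x) = 0" for X x v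
    by (rule hs_wnorm_eq_0D[OF H F HS bops_diff[OF F that(1) Z] that(2)])
  \<comment> \<open>The value \<open>?G x\<close> is attained, so minimising \<open>?J\<close> over both variables is minimising \<open>?G\<close>.\<close>
  have J_Z: "?J (?Z x, x) = ?G x" for x
    using wnorm_0[OF Z, of x x] by (simp add: J[OF Z] hs_0)
  have "\<exists>!x. \<forall>y. ?G x \<le> ?G y"
  proof (rule fractional_minimum_ex1[OF H F _ \<open>\<rho> > 0\<close>])
    show "bounded_linear (\<lambda>x. blinfun_apply (op_sqrt F W) (blinfun_apply A x))"
      by (intro bounded_linear_compose[OF blinfun.bounded_linear_right] blinfun.bounded_linear_right)
    show "?G x = (norm (blinfun_apply (op_sqrt F W) (blinfun_apply A x) - blinfun_apply (op_sqrt F W) b))\<^sup>2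
        / (1 + (norm x)\<^sup>2) + \<rho> * (norm x)\<^sup>2" for x
      by (simp add: G_fun_def wnorm_def blinfun.diff_right)
  qed (rule assms(7))
  then obtain x0 where x0: "\<And>y. ?G x0 \<le> ?G y" and x0_unique: "\<And>x. \<forall>y. ?G x \<le> ?G y \<Longrightarrow> x = x0"
    by metis
  have sol_iff: "?sol (X, x) \<longleftrightarrow> X \<in> bops H F \<and> x = x0 \<and> hs_wnorm H F W (X - ?Z x0) = 0" for X x
  proof
    assume "?sol (X, x)"
    then have X: "X \<in> bops H F" and min: "?J (X, x) \<le> ?J (?Z y, y)" for y
      using Z[of y] by (auto simp: rtls_solution_def is_arg_min_def not_less)
    have "?G x \<le> ?J (X, x)"
      using J[OF X] by simp
    then have "x = x0"
      using min by (intro x0_unique) (auto simp: J_Z intro: order_trans)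
    moreover have "(hs_wnorm H F W (X - ?Z x))\<^sup>2 \<le> 0"
      using min[of x] J[OF X, of x] J_Z[of x] zero_le_power2[of "wnorm F W (blinfun_apply (X - ?Z x) x)"]
      by linarith
    ultimately show "X \<in> bops H F \<and> x = x0 \<and> hs_wnorm H F W (X - ?Z x0) = 0"
      using X by simp
  next
    assume r: "X \<in> bops H F \<and> x = x0 \<and> hs_wnorm H F W (X - ?Z x0) = 0"
    then have "?J (X, x) = ?G x0"
      using wnorm_0[of X x0 x0] by (simp add: J)
    moreover have "?G x0 \<le> ?J (Y, y)" if "Y \<in> bops H F" for Y y
      using x0[of y] J[OF that, of y] by (smt (verit) zero_le_power2)
    ultimately show "?sol (X, x)"
      using r by (auto simp: rtls_solution_def is_arg_min_def not_less)
  qed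
  moreover have "\<exists>!p. ?sol p" if inj: "\<forall>z. wnorm F W z = 0 \<longrightarrow> z = 0"
  proof (rule ex1I)
    show "?sol (?Z x0, x0)"
      using Z by (simp add: sol_iff hs_0)
    fix p assume p: "?sol p"
    obtain X x where "p = (X, x)"
      by (cases p)
    then have X: "X \<in> bops H F" "x = x0" "hs_wnorm H F W (X - ?Z x0) = 0"
      using p by (auto simp: sol_iff)
    have "blinfun_apply (X - ?Z x0) v = 0" for v
      using wnorm_0[OF X(1,3)] inj by blast
    then have "X = ?Z x0"
      by (intro blinfun_eqI) (simp add: blinfun.diff_left)
    then show "p = (?Z x0, x0)"
      using \<open>p = (X, x)\<close> X(2) by simp
  qed
  ultimately show ?thesis
    using Z by blast
qed

end
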